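(* Let $\tau\in(0,\infty)$, let $\mu_1$ be a non-negative Borel measure on $[0,\tau]$ with $M:=\mu_1([0,\tau])\in(0,\infty)$, and let $f\in C(\mathbb{R}^+;(0,\infty))$, $\mathbb{R}^+=[0,\infty)$, be locally Lipschitz continuous and regularly varying at infinity with index $0$. Let $\psi\in C([-\tau,0];(0,\infty))$. Put $F(x)=\int_1^x \frac{du}{f(u)}$ for $x>0$. Then the unique continuous solution $z$ of $$z'(t)=\int_{[0,\tau]}\mu_1(ds)f(z(t-s)),\quad t\ge 0;\qquad z(t)=\psi(t),\ t\in[-\tau,0],$$ obeys $$\lim_{t\to\infty}z(t)=\infty,\qquad \lim_{t\to\infty}\frac{z(t)}{F^{-1}(Mt)}=1.$$
   Context: A measurable function $h:\mathbb{R}^+\to(0,\infty)$ is regularly varying at infinity with index $\beta\in\mathbb{R}$ (written $h\in\mathrm{RV}_\infty(\beta)$) if $\lim_{x\to\infty}h(\lambda x)/h(x)=\lambda^\beta$ for all $\lambda>0$. $F$ is strictly increasing; $F^{-1}$ is its inverse function. At $t=0$ the derivative $z'$ is the right derivative. *)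

theory Defs
  imports "HOL-Analysis.Analysis"
begin

text \<open>Functions on \<open>[0, \<infinity>)\<close> are modelled as functions \<open>real \<Rightarrow> real\<close> of which only the values on
  \<open>{0..}\<close> matter.\<close>

definition regularly_varying :: "real \<Rightarrow> (real \<Rightarrow> real) \<Rightarrow> bool" where
  "regularly_varying \<beta> h \<longleftrightarrow>
     h \<in> borel_measurable (restrict_space borel {0..}) \<and>
     (\<forall>x\<ge>0. 0 < h x) \<and>
     (\<forall>c>0. ((\<lambda>x. h (c * x) / h x) \<longlongrightarrow> c powr \<beta>) at_top)"

text \<open>The library notion concerns families of functions with a parameter; here the
  family is constant.\<close>

definition locally_lipschitz_on :: "real set \<Rightarrow> (real \<Rightarrow> real) \<Rightarrow> bool" where
  "locally_lipschitz_on S h \<longleftrightarrow> local_lipschitz (UNIV :: real set) S (\<lambda>_. h)"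

text \<open>The interval integral is oriented, so the values are negative for \<open>0 < x < 1\<close>.\<close>

definition osgood :: "(real \<Rightarrow> real) \<Rightarrow> real \<Rightarrow> real" where
  "osgood f x = (LBINT u=1..x. 1 / f u)"

definition osgood_inv :: "(real \<Rightarrow> real) \<Rightarrow> real \<Rightarrow> real" where
  "osgood_inv f = the_inv_into {0<..} (osgood f)"

text \<open>The condition \<open>0 \<le> z t\<close> says that \<open>z\<close> takes its values in the domain \<open>[0, \<infinity>)\<close> of \<open>f\<close>.
  The derivative within \<open>{0..}\<close> is the right derivative at \<open>0\<close> and the ordinary
  two-sided derivative at every \<open>t > 0\<close>.\<close>

definition delay_solution ::
  "real \<Rightarrow> real measure \<Rightarrow> (real \<Rightarrow> real) \<Rightarrow> (real \<Rightarrow> real) \<Rightarrow> (real \<Rightarrow> real) \<Rightarrow> bool" where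
  "delay_solution \<tau> \<mu> f \<psi> z \<longleftrightarrow>
     continuous_on {-\<tau>..} z \<and>
     (\<forall>t\<ge>-\<tau>. 0 \<le> z t) \<and>
     (\<forall>t\<in>{-\<tau>..0}. z t = \<psi> t) \<and>
     (\<forall>t\<ge>0. (z has_real_derivative (LINT s|\<mu>. f (z (t - s)))) (at t within {0..}))"

end

theory Submission
  imports Defs
begin

text \<open>Existence and uniqueness: with the weight \<open>exp (- \<lambda> * t)\<close> the equation is a contraction as
  soon as \<open>f\<close> is bounded and Lipschitz, and since slow variation makes \<open>f\<close> sublinear, truncating \<open>f\<close>
  at a large height changes nothing on a given bounded interval.

  Asymptotics: sublinearity of \<open>f\<close> gives \<open>z (t - \<tau>) / z t \<longlonglongrightarrow> 1\<close>, hence by Karamata's uniform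
  convergence theorem \<open>f (z (t - s)) / f (z t) \<longlonglongrightarrow> 1\<close> uniformly in \<open>s\<close> and \<open>z' t / f (z t) \<longlonglongrightarrow> M\<close>.
  By l'Hospital, \<open>F (z t) / t \<longlonglongrightarrow> M\<close>. Again by l'Hospital \<open>F (c * x) / F x \<longlonglongrightarrow> c\<close> for every
  \<open>c > 0\<close>, so that \<open>F (z t)\<close> and \<open>F (F\<^sup>-\<^sup>1 (M * t))\<close> can only be asymptotic if \<open>z t\<close> and
  \<open>F\<^sup>-\<^sup>1 (M * t)\<close> are.\<close>

section \<open>Delay equations with a Lipschitz nonlinearity\<close>

lemma at_within_Ici_pos: "0 < t \<Longrightarrow> at t within {0..} = at (t :: real)"
  by (rule at_within_interior) (simp add: interior_real_atLeast)

text \<open>The mean value theorem in the form that fits \<open>delay_solution\<close>: derivatives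
  are taken within \<open>{0..}\<close>, so that \<open>a = 0\<close> is allowed. The sign is asked
  for only on \<open>{a..b}\<close>, since some bounds on the derivative hold only at late
  times.\<close>

lemma nondecreasing_if_DERIV_nonneg:
  fixes h :: "real \<Rightarrow> real"
  assumes der: "\<And>t. t \<in> {0..b} \<Longrightarrow> (h has_real_derivative h' t) (at t within {0..})"
    and nonneg: "\<And>t. t \<in> {a..b} \<Longrightarrow> 0 \<le> h' t"
    and ab: "0 \<le> a" "a \<le> b"
  shows "h a \<le> h b"
proof (rule DERIV_nonneg_imp_increasing_open[OF ab(2)])
  fix t assume "a < t" "t < b"
  then show "\<exists>d. (h has_real_derivative d) (at t) \<and> 0 \<le> d"
    using der[of t] nonneg[of t] ab at_within_Ici_pos[of t] by (intro exI[of _ "h' t"]) auto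
next
  have "continuous_on {0..b} h"
    by (rule DERIV_continuous_on) (rule DERIV_subset[OF der], auto)
  then show "continuous_on {a..b} h" by (rule continuous_on_subset) (use ab in auto)
qed

lemma locally_lipschitz_on_Icc:
  assumes "locally_lipschitz_on {0..} f"
  obtains L where "L-lipschitz_on {0..K} f"
proof -
  have "local_lipschitz {0 :: real} {0..K} (\<lambda>_. f)"
    using assms unfolding locally_lipschitz_on_def by (rule local_lipschitz_subset) auto
  then show thesis
    by (rule local_lipschitz_compact_implies_lipschitz[of "{0}" "{0..K}" "\<lambda>_. f"]) (auto intro: that)
qed

text \<open>Compare \<open>h\<close> and \<open>- h\<close> with the primitive
  \<open>D / lam * exp (lam * t)\<close> of the bound. The gained factor \<open>1 / lam\<close>
  makes the weighted estimates contract, both for existence and for uniqueness.\<close>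

lemma exp_growth_bound:
  fixes h h' :: "real \<Rightarrow> real"
  assumes T: "0 \<le> T" and lam: "0 < lam" and D: "0 \<le> D" and h0: "h 0 = 0"
    and der: "\<And>t. t \<in> {0..T} \<Longrightarrow> (h has_real_derivative h' t) (at t within {0..})"
    and bound: "\<And>t. t \<in> {0..T} \<Longrightarrow> \<bar>h' t\<bar> \<le> D * exp (lam * t)"
  shows "\<bar>h T\<bar> \<le> D / lam * exp (lam * T)"
proof -
  have der': "(h has_real_derivative h' t) (at t within {0..T})" if "t \<in> {0..T}" for t
    using der[OF that] by (rule DERIV_subset) auto
  have E: "((\<lambda>t. D / lam * exp (lam * t)) has_real_derivative D * exp (lam * t)) (at t within {0..T})" for t
    using lam by (auto intro!: derivative_eq_intros)
  have cont: "continuous_on {0..T} h"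
    using der' by (rule DERIV_continuous_on)
  have mono: "D / lam * exp (lam * 0) + c * h 0 \<le> D / lam * exp (lam * T) + c * h T" if c: "\<bar>c\<bar> = 1" for c
  proof (rule DERIV_nonneg_imp_increasing_open[OF T])
    show "continuous_on {0..T} (\<lambda>t. D / lam * exp (lam * t) + c * h t)"
      by (intro continuous_intros cont) (use lam in auto)
    fix t assume t: "0 < t" "t < T"
    have "((\<lambda>t. D / lam * exp (lam * t) + c * h t) has_real_derivative D * exp (lam * t) + c * h' t) (at t within {0..T})"
      by (intro DERIV_add E DERIV_cmult der') (use t in auto)
    then have "((\<lambda>t. D / lam * exp (lam * t) + c * h t) has_real_derivative D * exp (lam * t) + c * h' t) (at t)"
      using t at_within_Icc_at[of 0 t T] by simp
    moreover have "\<bar>c * h' t\<bar> \<le> D * exp (lam * t)"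
      using bound[of t] t c by (simp add: abs_mult)
    ultimately show "\<exists>y. ((\<lambda>t. D / lam * exp (lam * t) + c * h t) has_real_derivative y) (at t) \<and> 0 \<le> y"
      by (intro exI[of _ "D * exp (lam * t) + c * h' t"] conjI) linarith+
  qed
  have "0 \<le> D / lam" using D lam by simp
  then show ?thesis using mono[of 1] mono[of "-1"] h0 by (simp add: abs_le_iff)
qed

section \<open>Integration against the delay measure\<close>

locale delay_measure =
  fixes \<tau> M :: real and \<mu> :: "real measure"
  assumes tau_pos: "0 < \<tau>"
    and sets_mu: "sets \<mu> = sets (restrict_space borel {0..\<tau>})"
    and emeasure_mu: "emeasure \<mu> {0..\<tau>} = ennreal M"
    and M_pos: "0 < M"
begin

lemma space_mu: "space \<mu> = {0..\<tau>}"
  using sets_eq_imp_space_eq[OF sets_mu] by (simp add: space_restrict_space)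

sublocale finite_measure \<mu>
  by standard (simp add: space_mu emeasure_mu)

lemma measure_mu: "measure \<mu> (space \<mu>) = M"
  using emeasure_mu M_pos by (simp add: measure_def space_mu)

lemma integrable_continuous:
  fixes g :: "real \<Rightarrow> real"
  assumes "continuous_on {0..\<tau>} g"
  shows "integrable \<mu> g"
proof -
  have meas: "g \<in> borel_measurable \<mu>"
    using borel_measurable_continuous_on_restrict[OF assms] measurable_cong_sets[OF sets_mu refl]
    by blast
  have "bounded (g ` {0..\<tau>})"
    using assms by (intro compact_imp_bounded compact_continuous_image) auto
  then obtain B where "\<And>s. s \<in> {0..\<tau>} \<Longrightarrow> norm (g s) \<le> B"
    unfolding bounded_iff by blast
  then show ?thesis
    by (intro integrable_const_bound[OF _ meas, of B] AE_I2) (simp add: space_mu)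
qed

lemma integral_upper:
  fixes g :: "real \<Rightarrow> real"
  assumes "continuous_on {0..\<tau>} g" "\<And>s. s \<in> {0..\<tau>} \<Longrightarrow> g s \<le> B"
  shows "(LINT s|\<mu>. g s) \<le> M * B"
proof -
  have "(LINT s|\<mu>. g s) \<le> (LINT s|\<mu>. B)"
    using assms by (intro integral_mono integrable_continuous) (auto simp: space_mu)
  then show ?thesis by (simp add: measure_mu)
qed

lemma integral_lower:
  fixes g :: "real \<Rightarrow> real"
  assumes "continuous_on {0..\<tau>} g" "\<And>s. s \<in> {0..\<tau>} \<Longrightarrow> B \<le> g s"
  shows "M * B \<le> (LINT s|\<mu>. g s)"
proof -
  have "(LINT s|\<mu>. B) \<le> (LINT s|\<mu>. g s)"
    using assms by (intro integral_mono integrable_continuous) (auto simp: space_mu)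
  then show ?thesis by (simp add: measure_mu)
qed

lemma integral_diff_bound:
  fixes g k :: "real \<Rightarrow> real"
  assumes "continuous_on {0..\<tau>} g" "continuous_on {0..\<tau>} k"
    and "\<And>s. s \<in> {0..\<tau>} \<Longrightarrow> \<bar>g s - k s\<bar> \<le> B"
  shows "\<bar>(LINT s|\<mu>. g s) - (LINT s|\<mu>. k s)\<bar> \<le> M * B"
proof -
  have "(LINT s|\<mu>. g s) - (LINT s|\<mu>. k s) = (LINT s|\<mu>. g s - k s)"
    using assms by (simp add: integrable_continuous)
  moreover have "(LINT s|\<mu>. g s - k s) \<le> M * B"
    using assms(3) by (intro integral_upper continuous_intros assms(1,2)) (auto simp: abs_le_iff)
  moreover have "M * (- B) \<le> (LINT s|\<mu>. g s - k s)"
    using assms(3) by (intro integral_lower continuous_intros assms(1,2)) (force simp: abs_le_iff)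
  ultimately show ?thesis by (simp add: abs_le_iff)
qed

text \<open>Dominated convergence along sequences with majorant \<open>B\<close>, integrable because
  the measure is finite. This keeps the fixed point map among the bounded continuous
  functions.\<close>

lemma continuous_delay_integral:
  fixes g :: "real \<Rightarrow> real"
  assumes g: "continuous_on UNIV g" and B: "\<And>x. \<bar>g x\<bar> \<le> B"
  shows "continuous_on UNIV (\<lambda>t. LINT s|\<mu>. g (t - s))"
proof -
  have gt: "continuous_on A (\<lambda>s. g (t - s))" for A t
    by (intro continuous_on_compose2[OF g] continuous_intros) auto
  show ?thesis
  proof (unfold continuous_on_sequentially, safe)
    fix x :: "nat \<Rightarrow> real" and a assume x: "x \<longlonglongrightarrow> a"
    have "(\<lambda>n. LINT s|\<mu>. g (x n - s)) \<longlonglongrightarrow> (LINT s|\<mu>. g (a - s))"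
    proof (rule integral_dominated_convergence[where w = "\<lambda>_. B"])
      show "AE s in \<mu>. (\<lambda>n. g (x n - s)) \<longlonglongrightarrow> g (a - s)"
      proof (rule AE_I2)
        fix s
        have "isCont g (a - s)" using g by (simp add: continuous_on_eq_continuous_at)
        then show "(\<lambda>n. g (x n - s)) \<longlonglongrightarrow> g (a - s)"
          by (rule isCont_tendsto_compose) (intro tendsto_intros x)
      qed
    qed (use B integrable_continuous[OF gt] in auto)
    then show "((\<lambda>t. LINT s|\<mu>. g (t - s)) \<circ> x) \<longlonglongrightarrow> (LINT s|\<mu>. g (a - s))"
      by (simp add: o_def)
  qed
qed

text \<open>The unknown of the contraction is the weighted derivative \<open>y t = exp (- \<lambda> * t) * z' t\<close>,
  which for bounded \<open>g\<close> is automatically bounded and carries no boundary condition.\<close>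

lemma delay_equation_lipschitz_existence:
  fixes g \<phi> :: "real \<Rightarrow> real"
  assumes lip: "L-lipschitz_on UNIV g" and B: "\<And>x. \<bar>g x\<bar> \<le> B"
    and \<phi>: "continuous_on UNIV \<phi>"
  obtains z where "continuous_on UNIV z" "\<And>t. t \<le> 0 \<Longrightarrow> z t = \<phi> t"
    "\<And>t. 0 \<le> t \<Longrightarrow> (z has_real_derivative (LINT s|\<mu>. g (z (t - s)))) (at t within {0..})"
proof -
  have L: "0 \<le> L" using lip by (rule lipschitz_on_nonneg)
  have g: "continuous_on UNIV g" using lip by (rule lipschitz_on_continuous_on)
  \<comment> \<open>Makes the contraction factor \<open>M * L / lam\<close> at most 1/2; the
    \<open>+ 1\<close> keeps \<open>lam\<close> positive when \<open>L = 0\<close>.\<close>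
  define lam where "lam = 2 * M * L + 1"
  have lam: "0 < lam" using L M_pos by (simp add: lam_def add_nonneg_pos)
  \<comment> \<open>\<open>I y\<close> integrates the unweighted derivative
    \<open>exp (lam * s) * y s\<close>, and \<open>Z y\<close> continues the history
    \<open>\<phi>\<close> by it; the clamps \<open>min\<close> and \<open>max\<close> give one
    formula on the whole line.\<close>
  define I where "I = (\<lambda>(y :: real \<Rightarrow>\<^sub>C real) t. integral {0..t} (\<lambda>s. exp (lam * s) * y s))"
  define Z where "Z = (\<lambda>y t. \<phi> (min t 0) + I y (max t 0))"
  define R where "R = (\<lambda>y t. LINT s|\<mu>. g (Z y (t - s)))"
  have derI: "(I y has_real_derivative exp (lam * t) * y t) (at t within {0..})" if "0 \<le> t" for y t
  proof -
    have "(I y has_real_derivative exp (lam * t) * y t) (at t within {0..t+1})"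
      unfolding I_def using that
      by (intro integral_has_real_derivative continuous_intros) auto
    moreover have "at t within {0..t+1} = at t within {0..}"
      by (rule at_within_nhd[of _ "{..<t+1}"]) auto
    ultimately show ?thesis by simp
  qed
  have contI: "continuous_on {0..} (I y)" for y
    using derI by (intro DERIV_continuous_on) auto
  have contZ: "continuous_on UNIV (Z y)" for y
    unfolding Z_def
    by (intro continuous_intros continuous_on_compose2[OF \<phi>] continuous_on_compose2[OF contI]) auto
  have derZ: "(Z y has_real_derivative exp (lam * t) * y t) (at t within {0..})" if "0 \<le> t" for y t
  proof -
    have "((\<lambda>t. \<phi> 0 + I y t) has_real_derivative exp (lam * t) * y t) (at t within {0..})"
      by (auto intro!: derivative_eq_intros derI that)
    then show ?thesis
      by (rule has_field_derivative_transform_within[where d=1]) (use that in \<open>auto simp: Z_def\<close>)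
  qed
  have contgZ: "continuous_on A (\<lambda>s. g (Z y (t - s)))" for A y t
    by (intro continuous_on_compose2[OF g] continuous_on_compose2[OF contZ] continuous_intros) auto
  have contR: "continuous_on UNIV (R y)" for y
    unfolding R_def
    by (rule continuous_delay_integral[OF _ B]) (intro continuous_on_compose2[OF g] contZ; simp)
  have boundR: "\<bar>R y t\<bar> \<le> M * B" for y t
  proof -
    have "(LINT s|\<mu>. g (Z y (t - s))) \<le> M * B"
      using B by (intro integral_upper contgZ) (simp add: abs_le_iff)
    moreover have "M * (- B) \<le> (LINT s|\<mu>. g (Z y (t - s)))"
      using B by (intro integral_lower contgZ) (simp add: abs_le_iff minus_le_iff)
    ultimately show ?thesis by (simp add: R_def abs_le_iff)
  qed
  \<comment> \<open>Frozen at its value at 0 for negative times, because bounded continuous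
    functions are a type of functions on the whole line.\<close>
  define S where "S = (\<lambda>y t. exp (- lam * max t 0) * R y (max t 0))"
  have S: "S y \<in> bcontfun" for y
  proof (rule bcontfun_normI[where b = "M * B"])
    show "continuous_on UNIV (S y)"
      unfolding S_def
      by (intro continuous_intros continuous_on_compose2[OF contR]) auto
    fix t
    have "norm (S y t) = exp (- lam * max t 0) * \<bar>R y (max t 0)\<bar>"
      by (simp add: S_def abs_mult)
    also have "\<dots> \<le> 1 * (M * B)"
      using lam by (intro mult_mono boundR) auto
    finally show "norm (S y t) \<le> M * B" by simp
  qed
  have diffZ: "\<bar>Z y t - Z y' t\<bar> \<le> dist y y' / lam * exp (lam * max t 0)" for y y' t
  proof (cases "0 \<le> t")
    case True
    have "\<bar>Z y t - Z y' t\<bar> \<le> dist y y' / lam * exp (lam * t)"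
    proof (rule exp_growth_bound[where h' = "\<lambda>t. exp (lam * t) * y t - exp (lam * t) * y' t"])
      show "Z y 0 - Z y' 0 = 0" by (simp add: Z_def I_def)
      fix s assume "s \<in> {0..t}"
      then show "((\<lambda>t. Z y t - Z y' t) has_real_derivative exp (lam * s) * y s - exp (lam * s) * y' s) (at s within {0..})"
        by (intro DERIV_diff derZ) auto
      have "\<bar>exp (lam * s) * y s - exp (lam * s) * y' s\<bar> = exp (lam * s) * dist (y s) (y' s)"
        by (simp add: dist_real_def abs_mult flip: right_diff_distrib)
      also have "\<dots> \<le> dist y y' * exp (lam * s)"
        using dist_bounded[of y s y'] by simp
      finally show "\<bar>exp (lam * s) * y s - exp (lam * s) * y' s\<bar> \<le> dist y y' * exp (lam * s)" .
    qed (use True lam in auto)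
    with True show ?thesis by simp
  next
    case False
    then show ?thesis using lam by (simp add: Z_def I_def)
  qed
  have "dist (Bcontfun (S y)) (Bcontfun (S y')) \<le> 1/2 * dist y y'" for y y'
  proof (rule dist_bound)
    fix t :: real
    define u where "u = max t 0"
    have "\<bar>R y u - R y' u\<bar> \<le> M * (L * (dist y y' / lam * exp (lam * u)))"
      unfolding R_def
    proof (intro integral_diff_bound contgZ)
      fix s assume s: "s \<in> {0..\<tau>}"
      have "\<bar>g (Z y (u - s)) - g (Z y' (u - s))\<bar> \<le> L * \<bar>Z y (u - s) - Z y' (u - s)\<bar>"
        using lipschitz_onD[OF lip] by (simp add: dist_real_def)
      also have "\<dots> \<le> L * (dist y y' / lam * exp (lam * max (u - s) 0))"
        by (intro mult_left_mono diffZ L)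
      \<comment> \<open>The delay can only lower the exponential weight.\<close>
      also have "\<dots> \<le> L * (dist y y' / lam * exp (lam * u))"
        using L lam s by (intro mult_left_mono) (auto simp: u_def intro!: divide_nonneg_pos)
      finally show "\<bar>g (Z y (u - s)) - g (Z y' (u - s))\<bar> \<le> L * (dist y y' / lam * exp (lam * u))" .
    qed
    moreover have "\<bar>S y t - S y' t\<bar> = exp (- (lam * u)) * \<bar>R y u - R y' u\<bar>"
      by (simp add: S_def u_def abs_mult flip: right_diff_distrib)
    ultimately have "\<bar>S y t - S y' t\<bar> \<le> exp (- (lam * u)) * (M * (L * (dist y y' / lam * exp (lam * u))))"
      by (metis exp_ge_zero mult_left_mono)
    also have "\<dots> = M * L / lam * dist y y'"
      by (simp add: exp_minus field_simps)
    also have "\<dots> \<le> 1/2 * dist y y'"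
      using lam by (intro mult_right_mono) (simp_all add: lam_def field_simps)
    finally show "dist (Bcontfun (S y) t) (Bcontfun (S y') t) \<le> 1/2 * dist y y'"
      using S by (simp add: Bcontfun_inverse dist_real_def)
  qed
  then obtain y where "Bcontfun (S y) = y"
    using banach_fix_type[of "1/2" "\<lambda>y. Bcontfun (S y)"] by auto
  then have y: "y t = S y t" for t
    using S by (metis Bcontfun_inverse)
  show ?thesis
  proof (rule that[of "Z y"])
    show "Z y t = \<phi> t" if "t \<le> 0" for t
      using that by (simp add: Z_def I_def)
    fix t :: real assume t: "0 \<le> t"
    \<comment> \<open>Freed of the weight, the fixed point equation is the delay equation.\<close>
    have "exp (lam * t) * y t = exp (lam * t) * (exp (- (lam * t)) * R y t)"
      using t y[of t] by (simp add: S_def)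
    also have "\<dots> = R y t" by (simp add: exp_minus)
    finally show "(Z y has_real_derivative (LINT s|\<mu>. g (Z y (t - s)))) (at t within {0..})"
      using derZ[OF t, of y] by (simp add: R_def)
  qed (rule contZ)
qed

text \<open>The weighted distance of \<open>u\<close> and \<open>v\<close> attains a maximum
  \<open>d m\<close> on \<open>{0..T}\<close>, and inserting it into the equation gives
  \<open>d m \<le> d m / 2\<close>. On a finite interval all values lie in some
  \<open>{0..K}\<close>, where \<open>f\<close> is Lipschitz. Finite \<open>T\<close> also allows
  comparing solutions known only up to different times.\<close>

lemma delay_equation_unique:
  fixes f u v :: "real \<Rightarrow> real"
  assumes ll: "locally_lipschitz_on {0..} f" and T: "0 \<le> T"
    and u: "continuous_on {-\<tau>..T} u" "\<And>t. t \<in> {-\<tau>..T} \<Longrightarrow> 0 \<le> u t"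
      "\<And>t. t \<in> {0..T} \<Longrightarrow> (u has_real_derivative (LINT s|\<mu>. f (u (t - s)))) (at t within {0..})"
    and v: "continuous_on {-\<tau>..T} v" "\<And>t. t \<in> {-\<tau>..T} \<Longrightarrow> 0 \<le> v t"
      "\<And>t. t \<in> {0..T} \<Longrightarrow> (v has_real_derivative (LINT s|\<mu>. f (v (t - s)))) (at t within {0..})"
    and init: "\<And>t. t \<in> {-\<tau>..0} \<Longrightarrow> u t = v t"
    and t: "t \<in> {-\<tau>..T}"
  shows "u t = v t"
proof -
  have "bounded (u ` {-\<tau>..T} \<union> v ` {-\<tau>..T})"
    using u(1) v(1) by (auto intro!: compact_imp_bounded compact_continuous_image)
  then obtain K where "\<forall>x \<in> u ` {-\<tau>..T} \<union> v ` {-\<tau>..T}. norm x \<le> K"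
    unfolding bounded_iff by blast
  then have uK: "u t \<in> {0..K}" and vK: "v t \<in> {0..K}" if "t \<in> {-\<tau>..T}" for t
    using that u(2) v(2) by (force simp: abs_le_iff)+
  obtain L where lip: "L-lipschitz_on {0..K} f"
    using locally_lipschitz_on_Icc[OF ll] by blast
  have L: "0 \<le> L" using lip by (rule lipschitz_on_nonneg)
  have f: "continuous_on {0..K} f" using lip by (rule lipschitz_on_continuous_on)
  define lam where "lam = 2 * M * L + 1"
  have lam: "0 < lam" using L M_pos by (simp add: lam_def add_nonneg_pos)
  define d where "d = (\<lambda>t. \<bar>u t - v t\<bar> * exp (- lam * t))"
  have "continuous_on {0..T} d"
    unfolding d_def using tau_pos
    by (intro continuous_intros continuous_on_subset[OF u(1)] continuous_on_subset[OF v(1)]) auto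
  then obtain m where m: "m \<in> {0..T}" and dm: "\<And>t. t \<in> {0..T} \<Longrightarrow> d t \<le> d m"
    using continuous_attains_sup[of "{0..T}" d] T by auto
  have d0: "0 \<le> d m" by (simp add: d_def)
  have diff: "\<bar>u t - v t\<bar> \<le> d m * exp (lam * t)" if "t \<in> {0..T}" for t
    using dm[OF that] by (simp add: d_def exp_minus field_simps)
  have "\<bar>u m - v m\<bar> \<le> (M * L * d m) / lam * exp (lam * m)"
  proof (rule exp_growth_bound[where h' = "\<lambda>t. (LINT s|\<mu>. f (u (t - s))) - (LINT s|\<mu>. f (v (t - s)))"])
    show "u 0 - v 0 = 0" using init tau_pos by simp
    fix t assume "t \<in> {0..m}"
    then have t: "t \<in> {0..T}" using m by auto
    then show "((\<lambda>t. u t - v t) has_real_derivative (LINT s|\<mu>. f (u (t - s))) - (LINT s|\<mu>. f (v (t - s)))) (at t within {0..})"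
      by (intro DERIV_diff u(3) v(3))
    have cont: "continuous_on {0..\<tau>} (\<lambda>s. f (w (t - s)))"
      if "continuous_on {-\<tau>..T} w" "\<And>t. t \<in> {-\<tau>..T} \<Longrightarrow> w t \<in> {0..K}" for w
      using t that(2)
      by (intro continuous_on_compose2[OF f] continuous_on_compose2[OF that(1)] continuous_intros) auto
    have "\<bar>(LINT s|\<mu>. f (u (t - s))) - (LINT s|\<mu>. f (v (t - s)))\<bar> \<le> M * (L * (d m * exp (lam * t)))"
    proof (intro integral_diff_bound cont u(1) v(1) uK vK)
      fix s assume s: "s \<in> {0..\<tau>}"
      have "\<bar>f (u (t - s)) - f (v (t - s))\<bar> \<le> L * \<bar>u (t - s) - v (t - s)\<bar>"
        using lipschitz_onD[OF lip uK vK] s t by (simp add: dist_real_def)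
      also have "\<dots> \<le> L * (d m * exp (lam * t))"
      proof (intro mult_left_mono L)
        show "\<bar>u (t - s) - v (t - s)\<bar> \<le> d m * exp (lam * t)"
        proof (cases "0 \<le> t - s")
          case True
          have "\<bar>u (t - s) - v (t - s)\<bar> \<le> d m * exp (lam * (t - s))"
            using True s t by (intro diff) auto
          also have "\<dots> \<le> d m * exp (lam * t)"
            using s lam d0 by (intro mult_left_mono) auto
          finally show ?thesis .
        next
          case False
          then show ?thesis using init[of "t - s"] s t d0 by simp
        qed
      qed
      finally show "\<bar>f (u (t - s)) - f (v (t - s))\<bar> \<le> L * (d m * exp (lam * t))" .
    qed
    then show "\<bar>(LINT s|\<mu>. f (u (t - s))) - (LINT s|\<mu>. f (v (t - s)))\<bar> \<le> M * L * d m * exp (lam * t)"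
      by (simp add: mult_ac)
  qed (use m lam L M_pos d0 in auto)
  then have "d m \<le> M * L / lam * d m"
    by (simp add: d_def exp_minus field_simps)
  also have "\<dots> \<le> 1/2 * d m"
    using lam d0 by (intro mult_right_mono) (simp_all add: lam_def field_simps)
  finally have "d m = 0" using d0 by simp
  then show ?thesis using diff[of t] init[of t] t by (cases "0 \<le> t") auto
qed

end

section \<open>Slowly varying functions\<close>

text \<open>Baire: otherwise the complements of the \<open>E n\<close> would be dense open sets with
  empty intersection.\<close>

lemma covering_interior:
  fixes E :: "nat \<Rightarrow> 'a :: {real_normed_vector, heine_borel} set"
  assumes closed: "\<And>n. closed (E n)" and cover: "(\<Union>n. E n) = UNIV"
  obtains n where "interior (E n) \<noteq> {}"
proof (rule ccontr)
  assume "\<not> thesis"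
  then have "interior (E n) = {}" for n using that by blast
  then have "(UNIV :: 'a set) \<subseteq> closure (\<Inter>(range (\<lambda>n. - E n)))"
    by (intro Baire) (auto simp: closure_complement open_Compl closed)
  moreover have "\<Inter>(range (\<lambda>n. - E n)) = {}" using cover by auto
  ultimately show False by simp
qed

locale slowly_varying =
  fixes f :: "real \<Rightarrow> real"
  assumes cont: "continuous_on {0..} f"
    and pos: "\<And>x. 0 \<le> x \<Longrightarrow> 0 < f x"
    and rv: "regularly_varying 0 f"
begin

lemma nonzero: "0 \<le> x \<Longrightarrow> f x \<noteq> 0"
  using pos[of x] by simp

lemma ratio_tendsto: "0 < c \<Longrightarrow> ((\<lambda>x. f (c * x) / f x) \<longlongrightarrow> 1) at_top"
  using rv by (simp add: regularly_varying_def)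

lemma bounded_initial:
  obtains A where "0 < A" "\<And>x. x \<in> {0..b} \<Longrightarrow> f x \<le> A"
proof -
  have "bounded (f ` {0..b})"
    by (intro compact_imp_bounded compact_continuous_image continuous_on_subset[OF cont]) auto
  then obtain A where "0 < A" "\<forall>x\<in>f ` {0..b}. norm x \<le> A"
    unfolding bounded_pos by blast
  then show ?thesis by (intro that[of A]) (auto simp: abs_le_iff)
qed

text \<open>Since \<open>f (2 * x) \<le> sqrt 2 * f x\<close> eventually, \<open>f\<close> grows at most like the square root.\<close>

lemma sublinear:
  assumes "0 < \<epsilon>"
  obtains C where "0 < C" "\<And>x. 0 \<le> x \<Longrightarrow> f x \<le> \<epsilon> * x + C"
proof -
  have "\<forall>\<^sub>F x in at_top. f (2 * x) / f x < sqrt 2"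
    by (rule order_tendstoD(2)[OF ratio_tendsto]) auto
  then obtain X0 where X0: "\<And>x. X0 \<le> x \<Longrightarrow> f (2 * x) / f x < sqrt 2"
    unfolding eventually_at_top_linorder by blast
  define X where "X = max X0 1"
  have double: "f (2 * x) \<le> sqrt 2 * f x" if "X \<le> x" for x
    using X0[of x] that pos[of x] by (auto simp: X_def divide_less_eq)
  have X: "1 \<le> X" by (simp add: X_def)
  obtain A where A: "0 < A" "\<And>x. x \<in> {0..2 * X} \<Longrightarrow> f x \<le> A"
    by (rule bounded_initial[of "2 * X"]) blast
  \<comment> \<open>Induction on the number of doublings between \<open>X\<close> and
    \<open>x\<close>; \<open>1 \<le> X\<close> lets the bound \<open>A\<close> on
    \<open>{0..2 * X}\<close> start it.\<close>
  have grow: "X \<le> x \<Longrightarrow> x \<le> 2 ^ n * X \<Longrightarrow> f x \<le> A * sqrt x" for n x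
  proof (induction n arbitrary: x)
    case 0
    have "A * 1 \<le> A * sqrt x" using 0 X A by (intro mult_left_mono) auto
    with 0 A(2)[of x] X show ?case by simp
  next
    case (Suc n)
    show ?case
    proof (cases "x \<le> 2 * X")
      case True
      have "A * 1 \<le> A * sqrt x" using Suc.prems X A by (intro mult_left_mono) auto
      with True Suc.prems A(2)[of x] X show ?thesis by simp
    next
      case False
      have "f x \<le> sqrt 2 * f (x / 2)" using double[of "x / 2"] False by simp
      also have "\<dots> \<le> sqrt 2 * (A * sqrt (x / 2))"
        using False Suc.prems by (intro mult_left_mono Suc.IH) auto
      also have "\<dots> = A * sqrt x" by (simp add: real_sqrt_divide)
      finally show ?thesis .
    qed
  qed
  \<comment> \<open>Completing the square in \<open>sqrt x\<close> trades the root for a prescribed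
    small slope and a constant.\<close>
  have sqrt_bound: "A * sqrt x \<le> \<epsilon> * x + A\<^sup>2 / (4 * \<epsilon>)" if "0 \<le> x" for x
  proof -
    have "0 \<le> (2 * \<epsilon> * sqrt x - A)\<^sup>2" by simp
    also have "\<dots> = 4 * \<epsilon> * (\<epsilon> * x + A\<^sup>2 / (4 * \<epsilon>) - A * sqrt x)"
      using that assms by (simp add: power2_eq_square algebra_simps)
    finally show ?thesis using assms by (simp add: zero_le_mult_iff)
  qed
  show ?thesis
  proof (rule that[of "A + A\<^sup>2 / (4 * \<epsilon>)"])
    show "0 < A + A\<^sup>2 / (4 * \<epsilon>)" using A assms by (simp add: add_pos_nonneg)
    fix x :: real assume x: "0 \<le> x"
    show "f x \<le> \<epsilon> * x + (A + A\<^sup>2 / (4 * \<epsilon>))"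
    proof (cases "x \<le> X")
      case True
      moreover have "0 \<le> \<epsilon> * x + A\<^sup>2 / (4 * \<epsilon>)" using x assms by simp
      ultimately show ?thesis using A(2)[of x] x X by simp
    next
      case False
      obtain n where "x / X < 2 ^ n" using real_arch_pow[of 2 "x / X"] by auto
      then have "f x \<le> A * sqrt x" using grow[of x n] False X by (simp add: divide_less_eq)
      then show ?thesis using sqrt_bound[OF x] A by simp
    qed
  qed
qed

text \<open>Karamata's uniform convergence theorem for continuous \<open>f\<close>, by Baire category: in the
  logarithmic variable the closed sets \<open>E n\<close> exhaust the line, so one of them contains an
  interval, which is then translated to the origin.\<close>

lemma uniform_ratio:
  assumes "0 < \<epsilon>"
  obtains \<delta> X where "1 < \<delta>" "0 < X"
    "\<And>x y. X \<le> x \<Longrightarrow> x \<le> y \<Longrightarrow> y \<le> \<delta> * x \<Longrightarrow> f y \<le> (1 + \<epsilon>) * f x \<and> f x \<le> (1 + \<epsilon>) * f y"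
proof -
  define h where "h = (\<lambda>x. ln (f (exp x)))"
  \<comment> \<open>Halved because \<open>h x\<close> and \<open>h (x + v)\<close> will be compared
    through the third value \<open>h (x - a)\<close>.\<close>
  define e where "e = ln (1 + \<epsilon>) / 2"
  have e: "0 < e" using assms by (simp add: e_def)
  have conth: "continuous_on UNIV h"
    unfolding h_def
    by (intro continuous_intros continuous_on_compose2[OF cont]) (auto simp: nonzero)
  have lim: "((\<lambda>x. h (x + u) - h x) \<longlongrightarrow> 0) at_top" for u
  proof -
    have "((\<lambda>x. ln (f (exp u * exp x) / f (exp x))) \<longlongrightarrow> ln 1) at_top"
      by (intro tendsto_ln filterlim_compose[OF ratio_tendsto exp_at_top]) auto
    then show ?thesis
      by (simp add: h_def ln_div nonzero exp_add mult.commute)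
  qed
  define E where "E = (\<lambda>n::nat. {u. \<forall>x\<ge>real n. \<bar>h (x + u) - h x\<bar> \<le> e})"
  have "closed (E n)" for n
  proof -
    have "closed {u. \<bar>h (x + u) - h x\<bar> \<le> e}" for x
      by (intro closed_Collect_le continuous_intros continuous_on_compose2[OF conth]) auto
    then have "closed (\<Inter>x\<in>{real n..}. {u. \<bar>h (x + u) - h x\<bar> \<le> e})" by blast
    moreover have "(\<Inter>x\<in>{real n..}. {u. \<bar>h (x + u) - h x\<bar> \<le> e}) = E n" by (auto simp: E_def)
    ultimately show ?thesis by simp
  qed
  moreover have "(\<Union>n. E n) = UNIV"
  proof -
    have "\<exists>n. u \<in> E n" for u
    proof -
      have "\<forall>\<^sub>F x in at_top. \<bar>h (x + u) - h x\<bar> < e"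
        using tendstoD[OF lim e] by (simp add: dist_real_def)
      then obtain x0 where "\<And>x. x0 \<le> x \<Longrightarrow> \<bar>h (x + u) - h x\<bar> < e"
        unfolding eventually_at_top_linorder by blast
      moreover have "x0 \<le> x" if "real (nat \<lceil>x0\<rceil>) \<le> x" for x using that by linarith
      ultimately have "u \<in> E (nat \<lceil>x0\<rceil>)" unfolding E_def mem_Collect_eq by (meson less_imp_le)
      then show ?thesis ..
    qed
    then show ?thesis by auto
  qed
  ultimately obtain n where "interior (E n) \<noteq> {}" by (rule covering_interior)
  then obtain a where "a \<in> interior (E n)" by blast
  then obtain r where r: "0 < r" "ball a r \<subseteq> E n"
    unfolding mem_interior by blast
  \<comment> \<open>Seen from \<open>x - a\<close>, the points \<open>x\<close> and
    \<open>x + v\<close> are the shifts by \<open>a\<close> and \<open>a + v\<close>, both in the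
    ball. The threshold on \<open>x\<close> guarantees \<open>real n \<le> x - a\<close>.\<close>
  have window: "\<bar>h (x + v) - h x\<bar> \<le> ln (1 + \<epsilon>)" if x: "real n + \<bar>a\<bar> \<le> x" and v: "0 \<le> v" "v < r" for x v
  proof -
    have "a \<in> E n" "a + v \<in> E n" using r v by (auto simp: subset_iff dist_real_def)
    moreover have "real n \<le> x - a" using x by linarith
    ultimately have "\<bar>h (x - a + a) - h (x - a)\<bar> \<le> e" "\<bar>h (x - a + (a + v)) - h (x - a)\<bar> \<le> e"
      unfolding E_def by blast+
    then have "\<bar>h x - h (x - a)\<bar> \<le> e" "\<bar>h (x + v) - h (x - a)\<bar> \<le> e" by simp_all
    then show ?thesis unfolding e_def by linarith
  qed
  show ?thesis
  \<comment> \<open>Half of \<open>r\<close>, since \<open>y \<le> \<delta> * x\<close> is a weak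
    inequality while the window is open.\<close>
  proof (rule that[of "exp (r / 2)" "exp (real n + \<bar>a\<bar>)"])
    show "1 < exp (r / 2)" using r by simp
    fix x y assume xy: "exp (real n + \<bar>a\<bar>) \<le> x" "x \<le> y" "y \<le> exp (r / 2) * x"
    have x0: "0 < x" using xy(1) by (meson exp_gt_zero less_le_trans)
    then have y0: "0 < y" using xy by simp
    have fpos: "0 < f x" "0 < f y" using x0 y0 pos by auto
    have "real n + \<bar>a\<bar> \<le> ln x" using xy(1) x0 by (simp add: ln_ge_iff)
    moreover have "0 \<le> ln y - ln x" using xy x0 y0 by simp
    moreover have "ln y - ln x < r"
    proof -
      have "ln y \<le> ln (exp (r / 2) * x)" using xy x0 y0 by (subst ln_le_cancel_iff) auto
      also have "\<dots> = r / 2 + ln x" using x0 by (simp add: ln_mult)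
      finally show ?thesis using r by simp
    qed
    ultimately have "\<bar>h (ln x + (ln y - ln x)) - h (ln x)\<bar> \<le> ln (1 + \<epsilon>)" by (rule window)
    then have "ln (f y) - ln (f x) \<le> ln (1 + \<epsilon>)" "ln (f x) - ln (f y) \<le> ln (1 + \<epsilon>)"
      using x0 y0 by (simp_all add: h_def abs_le_iff)
    then have "ln (f y) \<le> ln ((1 + \<epsilon>) * f x)" "ln (f x) \<le> ln ((1 + \<epsilon>) * f y)"
      using fpos assms by (simp_all add: ln_mult)
    then show "f y \<le> (1 + \<epsilon>) * f x \<and> f x \<le> (1 + \<epsilon>) * f y"
      using fpos assms by (simp add: ln_le_cancel_iff)
  qed simp
qed

section \<open>The transform \<open>osgood f\<close> and its inverse\<close>

lemma osgood_DERIV: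
  assumes "0 < x"
  shows "(osgood f has_real_derivative 1 / f x) (at x)"
proof -
  \<comment> \<open>The interval \<open>{0..x + 1}\<close> contains the base point 1 and has
    \<open>x\<close> in its interior, on whichever side of 1 \<open>x\<close> lies.\<close>
  have "((\<lambda>u. LBINT y=ereal 1..ereal u. 1 / f y) has_vector_derivative 1 / f x) (at x within {0..x + 1})"
    using assms nonzero
    by (intro interval_integral_FTC2 continuous_intros continuous_on_subset[OF cont]) auto
  then show ?thesis
    using assms at_within_Icc_at[of 0 x "x + 1"]
    by (simp add: osgood_def[abs_def] one_ereal_def has_real_derivative_iff_has_vector_derivative)
qed

lemma osgood_strict_mono:
  assumes "0 < x" "x < y"
  shows "osgood f x < osgood f y"
proof (rule DERIV_pos_imp_increasing[OF assms(2)])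
  fix u assume "x \<le> u" "u \<le> y"
  then show "\<exists>d. (osgood f has_real_derivative d) (at u) \<and> 0 < d"
    using assms(1) osgood_DERIV[of u] pos[of u] by (intro exI[of _ "1 / f u"]) auto
qed

text \<open>Since \<open>f x \<le> x + C\<close>, the derivative of \<open>osgood f\<close> is at
  least that of \<open>ln (C + x)\<close>, so \<open>osgood f\<close> grows at least
  logarithmically.\<close>

lemma osgood_at_top: "filterlim (osgood f) at_top at_top"
proof -
  obtain C where C: "0 < C" "\<And>x. 0 \<le> x \<Longrightarrow> f x \<le> 1 * x + C"
    by (rule sublinear[of 1]) auto
  have bound: "osgood f 1 - ln (C + 1) + ln (C + x) \<le> osgood f x" if "1 \<le> x" for x
  proof -
    have "osgood f 1 - ln (C + 1) \<le> osgood f x - ln (C + x)"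
    proof (rule DERIV_nonneg_imp_nondecreasing[OF that])
      fix u :: real assume "1 \<le> u" "u \<le> x"
      then show "\<exists>d. ((\<lambda>x. osgood f x - ln (C + x)) has_real_derivative d) (at u) \<and> 0 \<le> d"
        using C(1) C(2)[of u] pos[of u]
        by (intro exI[of _ "1 / f u - 1 / (C + u)"]) (auto intro!: derivative_eq_intros osgood_DERIV frac_le)
    qed
    then show ?thesis by simp
  qed
  have "filterlim (\<lambda>x. osgood f 1 - ln (C + 1) + ln (C + x)) at_top at_top"
    by (intro filterlim_tendsto_add_at_top[OF tendsto_const] filterlim_compose[OF ln_at_top]
        filterlim_ident)
  then show ?thesis
    by (rule filterlim_at_top_mono) (use bound in \<open>auto intro: eventually_at_top_linorderI[of 1]\<close>)
qed

text \<open>The quotient of the derivatives is \<open>c * f x / f (c * x)\<close>, which slow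
  variation sends to \<open>c\<close>.\<close>

lemma osgood_scaled:
  assumes c: "0 < c"
  shows "((\<lambda>x. osgood f (c * x) / osgood f x) \<longlongrightarrow> c) at_top"
proof (rule lhospital_at_top_at_top[OF osgood_at_top])
  show "\<forall>\<^sub>F x in at_top. ((\<lambda>x. osgood f (c * x)) has_real_derivative 1 / f (c * x) * c) (at x)"
    using eventually_gt_at_top[of 0]
  proof eventually_elim
    case (elim x)
    show ?case
      by (rule DERIV_chain2[OF osgood_DERIV]) (use c elim in \<open>auto intro!: derivative_eq_intros\<close>)
  qed
  show "\<forall>\<^sub>F x in at_top. (osgood f has_real_derivative 1 / f x) (at x)"
    using eventually_gt_at_top[of 0] by eventually_elim (rule osgood_DERIV)
  show "\<forall>\<^sub>F x in at_top. 1 / f x \<noteq> 0"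
    using eventually_gt_at_top[of 0] by eventually_elim (simp add: nonzero)
  have "((\<lambda>x. c * inverse (f (c * x) / f x)) \<longlongrightarrow> c * inverse 1) at_top"
    by (intro tendsto_intros ratio_tendsto c) auto
  then show "((\<lambda>x. 1 / f (c * x) * c / (1 / f x)) \<longlongrightarrow> c) at_top"
    by (simp add: field_simps)
qed

text \<open>Since \<open>osgood f\<close> vanishes at 1 and tends to infinity, the intermediate
  value theorem reaches every \<open>y \<ge> 0\<close>. Near 0 it stays bounded below, as
  \<open>f 0\<close> is positive, so very negative \<open>y\<close> have no preimage.\<close>

lemma osgood_inv:
  assumes "0 \<le> y"
  shows "0 < osgood_inv f y" "osgood f (osgood_inv f y) = y"
proof -
  have inj: "inj_on (osgood f) {0<..}"
    by (intro linorder_inj_onI) (use osgood_strict_mono in fastforce)+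
  obtain b where b: "1 \<le> b" "y \<le> osgood f b"
    using filterlim_at_top[THEN iffD1, OF osgood_at_top, rule_format, of y] eventually_ge_at_top[of 1]
    by (metis (mono_tags, lifting) eventually_at_top_linorder nle_le)
  have "osgood f 1 = 0"
    unfolding osgood_def using interval_integral_endpoints_same[of 1] by (simp add: one_ereal_def)
  then obtain x where "1 \<le> x" "osgood f x = y"
    using IVT'[of "osgood f" 1 y b] b assms
    by (metis DERIV_isCont continuous_at_imp_continuous_on atLeastAtMost_iff less_le_trans osgood_DERIV zero_less_one)
  then have y: "y \<in> osgood f ` {0<..}" by force
  show "0 < osgood_inv f y"
    using the_inv_into_into[OF inj y order_refl] by (simp add: osgood_inv_def)
  show "osgood f (osgood_inv f y) = y"
    using f_the_inv_into_f[OF inj y] by (simp add: osgood_inv_def)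
qed

lemma osgood_inv_at_top: "filterlim (osgood_inv f) at_top at_top"
  unfolding filterlim_at_top
proof
  fix K :: real
  show "\<forall>\<^sub>F y in at_top. K \<le> osgood_inv f y"
    \<comment> \<open>\<open>max K 1\<close> is positive, so strict monotonicity on
      \<open>{0<..}\<close> applies to it.\<close>
    using eventually_ge_at_top[of 0] eventually_gt_at_top[of "osgood f (max K 1)"]
  proof eventually_elim
    case (elim y)
    show ?case
    proof (rule ccontr)
      assume "\<not> K \<le> osgood_inv f y"
      then have "osgood f (osgood_inv f y) < osgood f (max K 1)"
        using osgood_inv(1)[OF elim(1)] by (intro osgood_strict_mono) auto
      then show False using elim osgood_inv(2) by simp
    qed
  qed
qed

text \<open>With \<open>y t = osgood_inv f (M * t)\<close>, the quotient
  \<open>osgood f (c * y t) / (M * t)\<close> tends to \<open>c\<close>, while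
  \<open>osgood f (z t) / (M * t)\<close> tends to 1. For \<open>c < 1\<close> the first is
  eventually smaller, whence \<open>c * y t < z t\<close> by strict monotonicity;
  \<open>c > 1\<close> is symmetric.\<close>

lemma osgood_inv_asymptotics:
  assumes z: "filterlim z at_top at_top" and M: "0 < M"
    and lim: "((\<lambda>t. osgood f (z t) / (M * t)) \<longlongrightarrow> 1) at_top"
  shows "((\<lambda>t. z t / osgood_inv f (M * t)) \<longlongrightarrow> 1) at_top"
proof -
  define y where "y = (\<lambda>t. osgood_inv f (M * t))"
  have y: "filterlim y at_top at_top"
    unfolding y_def using M
    by (intro filterlim_compose[OF osgood_inv_at_top] filterlim_tendsto_pos_mult_at_top[OF tendsto_const] filterlim_ident) auto
  have scaled: "((\<lambda>t. osgood f (c * y t) / (M * t)) \<longlongrightarrow> c) at_top" if "0 < c" for c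
  proof (rule Lim_transform_eventually[OF filterlim_compose[OF osgood_scaled[OF that] y]])
    show "\<forall>\<^sub>F t in at_top. osgood f (c * y t) / osgood f (y t) = osgood f (c * y t) / (M * t)"
      using eventually_ge_at_top[of 0] by eventually_elim (use M osgood_inv(2) in \<open>simp add: y_def\<close>)
  qed
  have z0: "\<forall>\<^sub>F t in at_top. 0 < z t" and y0: "\<forall>\<^sub>F t in at_top. 0 < y t"
    using z y unfolding filterlim_at_top_dense by auto
  have less: "u < v" if "osgood f u / (M * t) < osgood f v / (M * t)" "0 < t" "0 < u" "0 < v" for u v t
  proof (rule ccontr)
    assume "\<not> u < v"
    then have "osgood f v \<le> osgood f u" 
      using osgood_strict_mono[of v u] that by (cases "v = u") auto
    moreover have "osgood f u < osgood f v" using that M by (simp add: divide_less_cancel)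
    ultimately show False by simp
  qed
  have "((\<lambda>t. z t / y t) \<longlongrightarrow> 1) at_top"
  proof (rule order_tendstoI)
    fix a :: real assume a: "a < 1"
    \<comment> \<open>The maximum with 1/2 keeps \<open>c\<close> positive for every
      \<open>a\<close>; the midpoint below separates the limits \<open>c\<close> and 1.\<close>
    define c where "c = max a (1/2)"
    have c: "0 < c" "c < 1" "a \<le> c" using a by (auto simp: c_def)
    have mid: "c < (c + 1) / 2" "(c + 1) / 2 < 1" using c by auto
    show "\<forall>\<^sub>F t in at_top. a < z t / y t"
      using order_tendstoD(2)[OF scaled[OF c(1)] mid(1)] order_tendstoD(1)[OF lim mid(2)]
        z0 y0 eventually_gt_at_top[of 0]
    proof eventually_elim
      case (elim t)
      have "c * y t < z t"
        by (rule less[OF less_trans[OF elim(1,2)] elim(5)]) (use elim(3,4) c in simp_all)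
      then have "c < z t / y t" using elim(4) by (simp add: less_divide_eq)
      then show ?case using c by simp
    qed
  next
    fix c :: real assume c: "1 < c"
    then have c0: "0 < c" and mid: "1 < (c + 1) / 2" "(c + 1) / 2 < c" by auto
    show "\<forall>\<^sub>F t in at_top. z t / y t < c"
      using order_tendstoD(1)[OF scaled[OF c0] mid(2)] order_tendstoD(2)[OF lim mid(1)]
        z0 y0 eventually_gt_at_top[of 0]
    proof eventually_elim
      case (elim t)
      have "z t < c * y t"
        by (rule less[OF less_trans[OF elim(2,1)] elim(5)]) (use elim(3,4) c0 in simp_all)
      then show ?case using elim(4) by (simp add: divide_less_eq)
    qed
  qed
  then show ?thesis by (simp add: y_def)
qed

end

section \<open>The delay equation with a slowly varying nonlinearity\<close>

locale delay_problem = delay_measure \<tau> M \<mu> + slowly_varying f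
  for \<tau> M :: real and \<mu> :: "real measure" and f :: "real \<Rightarrow> real" +
  fixes \<psi> :: "real \<Rightarrow> real"
  assumes locally_lipschitz: "locally_lipschitz_on {0..} f"
    and cont_init: "continuous_on {-\<tau>..0} \<psi>"
    and init_pos: "\<And>t. t \<in> {-\<tau>..0} \<Longrightarrow> 0 < \<psi> t"
begin

section \<open>Existence and uniqueness of the solution\<close>

lemma init_bounded:
  obtains P where "0 < P" "\<And>t. t \<in> {-\<tau>..0} \<Longrightarrow> \<psi> t \<le> P"
proof -
  have "bounded (\<psi> ` {-\<tau>..0})"
    by (intro compact_imp_bounded compact_continuous_image cont_init) auto
  then obtain P where "0 < P" "\<forall>x\<in>\<psi> ` {-\<tau>..0}. norm x \<le> P"
    unfolding bounded_pos by blast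
  then show ?thesis by (intro that[of P]) (auto simp: abs_le_iff)
qed

text \<open>Truncating \<open>f\<close> above a bound \<open>K\<close> makes it bounded and Lipschitz. The linear growth of
  \<open>f\<close> gives, by Gronwall, a bound on \<open>{0..T}\<close> that does not depend on \<open>K\<close>, so for large \<open>K\<close> the
  truncation is not felt there.\<close>

lemma solution_on_bounded_interval:
  assumes T: "0 \<le> T"
  obtains z where "continuous_on UNIV z" "\<And>t. t \<in> {-\<tau>..0} \<Longrightarrow> z t = \<psi> t"
    "\<And>t. -\<tau> \<le> t \<Longrightarrow> 0 \<le> z t"
    "\<And>t. t \<in> {0..T} \<Longrightarrow> (z has_real_derivative (LINT s|\<mu>. f (z (t - s)))) (at t within {0..})"
proof -
  obtain C where C: "0 < C" "\<And>x. 0 \<le> x \<Longrightarrow> f x \<le> 1 * x + C"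
    by (rule sublinear[of 1]) auto
  obtain P where P: "0 < P" "\<And>t. t \<in> {-\<tau>..0} \<Longrightarrow> \<psi> t \<le> P"
    using init_bounded by blast
  \<comment> \<open>The Gronwall bound at time \<open>T\<close>, starting from
    \<open>z 0 + P + C \<le> P + P + C\<close>.\<close>
  define K where "K = (P + P + C) * exp (M * T)"
  have "(P + P + C) * 1 \<le> K"
    unfolding K_def using P C M_pos T by (intro mult_left_mono) auto
  then have PK: "P \<le> K" and K: "0 \<le> K" using P C by auto
  obtain L where lip: "L-lipschitz_on {0..K} f"
    using locally_lipschitz_on_Icc[OF locally_lipschitz] by blast
  have L: "0 \<le> L" using lip by (rule lipschitz_on_nonneg)
  \<comment> \<open>The clamp at 0 extends \<open>f\<close> to negative arguments, where nothing is
    known about it.\<close>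
  define g where "g = (\<lambda>x. f (max 0 (min x K)))"
  define \<phi> where "\<phi> = (\<lambda>t. \<psi> (max (-\<tau>) (min t 0)))"
  have lipg: "L-lipschitz_on UNIV g"
  proof (rule lipschitz_onI[OF _ L])
    fix x y :: real
    have "dist (g x) (g y) \<le> L * dist (max 0 (min x K)) (max 0 (min y K))"
      unfolding g_def using K by (intro lipschitz_onD[OF lip]) auto
    also have "\<dots> \<le> L * dist x y"
      using L by (intro mult_left_mono) (auto simp: dist_real_def)
    finally show "dist (g x) (g y) \<le> L * dist x y" .
  qed
  have contg: "continuous_on UNIV g" using lipg by (rule lipschitz_on_continuous_on)
  have gpos: "0 \<le> g x" for x using pos[of "max 0 (min x K)"] by (simp add: g_def)
  have glin: "g x \<le> x + C" if "0 \<le> x" for x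
    using C(2)[of "min x K"] that K by (auto simp: g_def)
  have gB: "\<bar>g x\<bar> \<le> K + C" for x
    using C(2)[of "max 0 (min x K)"] gpos[of x] K by (auto simp: g_def)
  have cont\<phi>: "continuous_on UNIV \<phi>"
    unfolding \<phi>_def using tau_pos
    by (intro continuous_on_compose2[OF cont_init] continuous_intros) auto
  obtain z where z: "continuous_on UNIV z" "\<And>t. t \<le> 0 \<Longrightarrow> z t = \<phi> t"
    and derz: "\<And>t. 0 \<le> t \<Longrightarrow> (z has_real_derivative (LINT s|\<mu>. g (z (t - s)))) (at t within {0..})"
    using delay_equation_lipschitz_existence[OF lipg gB cont\<phi>] by blast
  have contgz: "continuous_on {0..\<tau>} (\<lambda>s. g (z (t - s)))" for t
    by (intro continuous_on_compose2[OF contg] continuous_on_compose2[OF z(1)] continuous_intros) auto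
  have init: "z t = \<psi> t" if "t \<in> {-\<tau>..0}" for t
    using that z(2)[of t] by (simp add: \<phi>_def)
  have nonneg: "0 \<le> (LINT s|\<mu>. g (z (t - s)))" for t
    using gpos by (intro Bochner_Integration.integral_nonneg) auto
  have mono: "z a \<le> z b" if "0 \<le> a" "a \<le> b" for a b
    by (rule nondecreasing_if_DERIV_nonneg[OF derz nonneg that]) auto
  have zpos: "0 \<le> z t" if "-\<tau> \<le> t" for t
  proof (cases "t \<le> 0")
    case True
    then show ?thesis using that init init_pos by (simp add: less_imp_le)
  next
    case False
    then show ?thesis using mono[of 0 t] init[of 0] init_pos[of 0] tau_pos by simp
  qed
  have deriv_le: "(LINT s|\<mu>. g (z (t - s))) \<le> M * (z t + P + C)" if "0 \<le> t" for t
  proof (intro integral_upper contgz)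
    fix s assume s: "s \<in> {0..\<tau>}"
    \<comment> \<open>The summand \<open>P\<close> covers delayed times in the history, where
      \<open>\<psi>\<close> may exceed \<open>z t\<close>.\<close>
    have "z (t - s) \<le> z t + P"
    proof (cases "0 \<le> t - s")
      case True
      then show ?thesis using mono[of "t - s" t] s P by simp
    next
      case False
      then show ?thesis using init[of "t - s"] P(2)[of "t - s"] zpos[of t] s that tau_pos by simp
    qed
    then show "g (z (t - s)) \<le> z t + P + C"
      using glin[OF zpos[of "t - s"]] s that by simp
  qed
  have upper: "z t \<le> K" if t: "t \<in> {-\<tau>..T}" for t
  proof (cases "t \<le> 0")
    case True
    then show ?thesis using init[of t] P(2)[of t] t PK by simp
  next
    case False
    \<comment> \<open>Gronwall with the integrating factor \<open>exp (- (M * t))\<close>; the minus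
      sign turns decrease into the increase that the monotonicity lemma yields.\<close>
    let ?h = "\<lambda>t. - ((z t + P + C) * exp (- (M * t)))"
    let ?h' = "\<lambda>t. exp (- (M * t)) * (M * (z t + P + C) - (LINT s|\<mu>. g (z (t - s))))"
    have "?h 0 \<le> ?h t"
    proof (rule nondecreasing_if_DERIV_nonneg[where h = ?h and h' = ?h'])
      fix u assume "u \<in> {0..t}"
      then have u: "0 \<le> u" by simp
      show "(?h has_real_derivative ?h' u) (at u within {0..})"
        by (auto intro!: derivative_eq_intros derz u simp: algebra_simps)
      show "0 \<le> ?h' u" using deriv_le[OF u] by simp
    qed (use False in auto)
    then have "z t + P + C \<le> (z 0 + P + C) * exp (M * t)"
      by (simp add: exp_minus field_simps)
    also have "\<dots> \<le> K"
      unfolding K_def using init[of 0] P C tau_pos M_pos t False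
      by (intro mult_mono) auto
    finally show ?thesis using P C by simp
  qed
  show ?thesis
  proof (rule that[OF z(1) init zpos])
    fix t assume t: "t \<in> {0..T}"
    have "(LINT s|\<mu>. g (z (t - s))) = (LINT s|\<mu>. f (z (t - s)))"
    proof (rule Bochner_Integration.integral_cong[OF refl])
      fix s assume "s \<in> space \<mu>"
      then have "0 \<le> z (t - s)" "z (t - s) \<le> K" using t by (auto simp: space_mu intro: zpos upper)
      then show "g (z (t - s)) = f (z (t - s))" by (simp add: g_def)
    qed
    then show "(z has_real_derivative (LINT s|\<mu>. f (z (t - s)))) (at t within {0..})"
      using derz[of t] t by simp
  qed auto
qed

text \<open>Solutions on \<open>{0..n}\<close> agree where they overlap, by uniqueness, and so glue
  to a global one.\<close>

lemma solution_exists: "\<exists>z. delay_solution \<tau> \<mu> f \<psi> z"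
proof -
  have "\<forall>n::nat. \<exists>z. continuous_on UNIV z \<and> (\<forall>t\<in>{-\<tau>..0}. z t = \<psi> t) \<and> (\<forall>t\<ge>-\<tau>. 0 \<le> z t) \<and>
    (\<forall>t\<in>{0..real n}. (z has_real_derivative (LINT s|\<mu>. f (z (t - s)))) (at t within {0..}))"
    using solution_on_bounded_interval[OF of_nat_0_le_iff] by metis
  from choice[OF this] obtain Z
    where "\<forall>n::nat. continuous_on UNIV (Z n) \<and> (\<forall>t\<in>{-\<tau>..0}. Z n t = \<psi> t) \<and> (\<forall>t\<ge>-\<tau>. 0 \<le> Z n t) \<and>
      (\<forall>t\<in>{0..real n}. (Z n has_real_derivative (LINT s|\<mu>. f (Z n (t - s)))) (at t within {0..}))"
    by blast
  then have Z: "\<And>n. continuous_on UNIV (Z n)"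
    and init: "\<And>n t. t \<in> {-\<tau>..0} \<Longrightarrow> Z n t = \<psi> t"
    and nonneg: "\<And>n t. -\<tau> \<le> t \<Longrightarrow> 0 \<le> Z n t"
    and der: "\<And>n t. t \<in> {0..real n} \<Longrightarrow> (Z n has_real_derivative (LINT s|\<mu>. f (Z n (t - s)))) (at t within {0..})"
    by blast+
  have eq: "Z m t = Z n t" if "m \<le> n" "t \<in> {-\<tau>..real m}" for m n t
  proof (rule delay_equation_unique[OF locally_lipschitz, where u = "Z m" and v = "Z n" and T = "real m" and t = t])
    show "(Z n has_real_derivative (LINT s|\<mu>. f (Z n (t - s)))) (at t within {0..})"
      if "t \<in> {0..real m}" for t
      using that \<open>m \<le> n\<close> by (intro der) auto
  qed (use that Z init nonneg der in \<open>auto intro: continuous_on_subset\<close>)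
  \<comment> \<open>For \<open>t \<le> 0\<close> the index is 0, and \<open>Z 0\<close> supplies the
    history.\<close>
  define z where "z = (\<lambda>t. Z (nat \<lceil>t\<rceil>) t)"
  have z: "z t = Z n t" if "t \<in> {-\<tau>..real n}" for t n
  proof (cases "nat \<lceil>t\<rceil> \<le> n")
    case True
    then show ?thesis unfolding z_def using that by (intro eq) (auto simp: real_nat_ceiling_ge)
  next
    case False
    then show ?thesis unfolding z_def using that by (intro eq[symmetric]) auto
  qed
  \<comment> \<open>The \<open>+ 1\<close> makes a single \<open>Z n\<close> represent
    \<open>z\<close> on a neighbourhood of \<open>t\<close>, as continuity and the derivative
    demand.\<close>
  have near: "z u = Z (nat \<lceil>t\<rceil> + 1) u" if "-\<tau> \<le> u" "dist u t < 1" for u t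
    using that real_nat_ceiling_ge[of t] by (intro z) (auto simp: dist_real_def)
  have "delay_solution \<tau> \<mu> f \<psi> z"
    unfolding delay_solution_def
  proof (intro conjI ballI allI impI)
    show "continuous_on {-\<tau>..} z"
      unfolding continuous_on_eq_continuous_within
    proof
      fix t assume t: "t \<in> {-\<tau>..}"
      have "continuous (at t within {-\<tau>..}) (Z (nat \<lceil>t\<rceil> + 1))"
        using Z by (simp add: continuous_on_eq_continuous_at continuous_at_imp_continuous_within)
      then show "continuous (at t within {-\<tau>..}) z"
        by (rule continuous_transform_within[where \<delta> = 1]) (use t near in auto)
    qed
    show "0 \<le> z t" if "-\<tau> \<le> t" for t using nonneg[OF that] by (simp add: z_def)
    show "z t = \<psi> t" if "t \<in> {-\<tau>..0}" for t using init[OF that] by (simp add: z_def)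
    fix t :: real assume t: "0 \<le> t"
    let ?n = "nat \<lceil>t\<rceil> + 1"
    have tn: "t \<le> real ?n" using real_nat_ceiling_ge[of t] by simp
    have "(LINT s|\<mu>. f (z (t - s))) = (LINT s|\<mu>. f (Z ?n (t - s)))"
    proof (rule Bochner_Integration.integral_cong[OF refl])
      fix s assume "s \<in> space \<mu>"
      then have "z (t - s) = Z ?n (t - s)" using t tn by (intro z) (auto simp: space_mu)
      then show "f (z (t - s)) = f (Z ?n (t - s))" by simp
    qed
    then have "(Z ?n has_real_derivative (LINT s|\<mu>. f (z (t - s)))) (at t within {0..})"
      using der[of t ?n] t tn by simp
    then show "(z has_real_derivative (LINT s|\<mu>. f (z (t - s)))) (at t within {0..})"
      by (rule has_field_derivative_transform_within[where d = 1]) (use t near tau_pos in auto)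
  qed
  then show ?thesis by blast
qed

lemma solution_unique:
  assumes "delay_solution \<tau> \<mu> f \<psi> w" "delay_solution \<tau> \<mu> f \<psi> z" "-\<tau> \<le> t"
  shows "w t = z t"
proof (rule delay_equation_unique[OF locally_lipschitz, where u = w and v = z and T = "max t 0" and t = t])
  show "continuous_on {-\<tau>..max t 0} w" "continuous_on {-\<tau>..max t 0} z"
    using assms(1,2) by (auto simp: delay_solution_def intro: continuous_on_subset)
qed (use assms in \<open>auto simp: delay_solution_def\<close>)

section \<open>Asymptotics of a given solution\<close>

context
  fixes z assumes sol: "delay_solution \<tau> \<mu> f \<psi> z"
begin

lemma sol_cont: "continuous_on {-\<tau>..} z"
  and sol_nonneg: "-\<tau> \<le> t \<Longrightarrow> 0 \<le> z t"
  and sol_init: "t \<in> {-\<tau>..0} \<Longrightarrow> z t = \<psi> t"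
  and sol_deriv: "0 \<le> t \<Longrightarrow> (z has_real_derivative (LINT s|\<mu>. f (z (t - s)))) (at t within {0..})"
  using sol by (auto simp: delay_solution_def)

lemma sol_cont_delayed: "0 \<le> t \<Longrightarrow> continuous_on {0..\<tau>} (\<lambda>s. f (z (t - s)))"
  by (intro continuous_on_compose2[OF cont] continuous_on_compose2[OF sol_cont] continuous_intros)
    (auto intro!: sol_nonneg)

lemma sol_deriv_nonneg: "0 \<le> t \<Longrightarrow> 0 \<le> (LINT s|\<mu>. f (z (t - s)))"
  by (intro Bochner_Integration.integral_nonneg less_imp_le[OF pos] sol_nonneg) (auto simp: space_mu)

lemma sol_mono:
  assumes "0 \<le> a" "a \<le> b"
  shows "z a \<le> z b"
  by (rule nondecreasing_if_DERIV_nonneg[OF sol_deriv sol_deriv_nonneg assms]) (use assms in auto)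

text \<open>If \<open>z\<close> stayed below \<open>K\<close>, then \<open>f\<close> would have a
  positive minimum over the compact range of \<open>z\<close>, and \<open>z\<close> would grow at
  least linearly. Monotonicity turns unboundedness into divergence.\<close>

lemma sol_at_top: "filterlim z at_top at_top"
  unfolding filterlim_at_top
proof
  fix K
  have "\<exists>t0\<ge>0. K \<le> z t0"
  proof (rule ccontr)
    assume "\<not> ?thesis"
    then have less: "z t < K" if "0 \<le> t" for t using that by force
    obtain P where P: "0 < P" "\<And>t. t \<in> {-\<tau>..0} \<Longrightarrow> \<psi> t \<le> P"
      using init_bounded by blast
    \<comment> \<open>Includes \<open>P\<close> because delayed arguments reach back into the
      history.\<close>
    define B where "B = max K P"
    have range: "z t \<in> {0..B}" if "-\<tau> \<le> t" for t
      using less[of t] P(2)[of t] sol_init[of t] sol_nonneg[OF that] that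
      by (cases "0 \<le> t") (auto simp: B_def)
    then have "{0..B} \<noteq> {}" using tau_pos by force
    then obtain x where x: "x \<in> {0..B}" "\<And>y. y \<in> {0..B} \<Longrightarrow> f x \<le> f y"
      using continuous_attains_inf[of "{0..B}" f] continuous_on_subset[OF cont, of "{0..B}"] by auto
    define m where "m = M * f x"
    have m: "0 < m" using x pos M_pos by (simp add: m_def)
    have "z 0 - m * 0 \<le> z t - m * t" if "0 \<le> t" for t
    proof (rule nondecreasing_if_DERIV_nonneg[where h = "\<lambda>t. z t - m * t" and h' = "\<lambda>t. (LINT s|\<mu>. f (z (t - s))) - m"])
      fix u assume "u \<in> {0..t}"
      then have u: "0 \<le> u" by simp
      show "((\<lambda>t. z t - m * t) has_real_derivative (LINT s|\<mu>. f (z (u - s))) - m) (at u within {0..})"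
        by (auto intro!: derivative_eq_intros sol_deriv u)
      have "m \<le> (LINT s|\<mu>. f (z (u - s)))"
        unfolding m_def using u by (intro integral_lower sol_cont_delayed x range) auto
      then show "0 \<le> (LINT s|\<mu>. f (z (u - s))) - m" by simp
    qed (use that in auto)
    \<comment> \<open>At this time linear growth has added \<open>\<bar>K\<bar>\<close> to
      \<open>z 0 \<ge> 0\<close>.\<close>
    from this[of "\<bar>K\<bar> / m"] less[of "\<bar>K\<bar> / m"] sol_nonneg[of 0] m tau_pos
    show False by simp
  qed
  then show "\<forall>\<^sub>F t in at_top. K \<le> z t"
    using sol_mono by (meson eventually_at_top_linorderI order_trans)
qed

lemma sol_shift_at_top: "filterlim (\<lambda>t. z (t - \<tau>)) at_top at_top"
proof -
  have "filterlim (\<lambda>t. - \<tau> + t) at_top at_top"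
    by (intro filterlim_tendsto_add_at_top[OF tendsto_const] filterlim_ident)
  from filterlim_compose[OF sol_at_top this] show ?thesis by simp
qed

text \<open>A delayed increment of \<open>z\<close> is at most \<open>\<tau> * M\<close> times the maximum of \<open>f\<close> on \<open>{0..z t}\<close>,
  which is small compared with \<open>z t\<close>.\<close>

lemma sol_lag:
  assumes \<delta>: "1 < \<delta>"
  shows "\<forall>\<^sub>F t in at_top. z t \<le> \<delta> * z (t - \<tau>)"
proof -
  \<comment> \<open>The claim is equivalent to
    \<open>z t - z (t - \<tau>) \<le> \<eta> * z t\<close>. Half of \<open>\<eta>\<close> is spent
    on the slope \<open>\<epsilon>\<close>, half on the constant \<open>C\<close> once
    \<open>z t\<close> is large.\<close>
  define \<eta> where "\<eta> = 1 - 1 / \<delta>"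
  have \<eta>: "0 < \<eta>" using \<delta> by (simp add: \<eta>_def)
  define \<epsilon> where "\<epsilon> = \<eta> / (2 * \<tau> * M)"
  have \<epsilon>: "0 < \<epsilon>" using \<eta> tau_pos M_pos by (simp add: \<epsilon>_def)
  obtain C where C: "0 < C" "\<And>x. 0 \<le> x \<Longrightarrow> f x \<le> \<epsilon> * x + C"
    using sublinear[OF \<epsilon>] by blast
  have large: "\<forall>\<^sub>F t in at_top. 2 * \<tau> * M * C / \<eta> \<le> z t"
    using sol_at_top by (simp add: filterlim_at_top)
  show ?thesis
    \<comment> \<open>From \<open>2 * \<tau>\<close> on all times \<open>u - s\<close> are
      nonnegative, where \<open>z\<close> is monotone; the history need not be.\<close>
    using large eventually_ge_at_top[of "2 * \<tau>"]
  proof eventually_elim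
    case (elim t)
    define k where "k = M * (\<epsilon> * z t + C)"
    have "k * (t - \<tau>) - z (t - \<tau>) \<le> k * t - z t"
    proof (rule nondecreasing_if_DERIV_nonneg[where h = "\<lambda>t. k * t - z t" and h' = "\<lambda>t. k - (LINT s|\<mu>. f (z (t - s)))"])
      show "((\<lambda>t. k * t - z t) has_real_derivative k - (LINT s|\<mu>. f (z (u - s)))) (at u within {0..})"
        if "u \<in> {0..t}" for u
        using that by (auto intro!: derivative_eq_intros sol_deriv)
      fix u assume u: "u \<in> {t - \<tau>..t}"
      have "(LINT s|\<mu>. f (z (u - s))) \<le> k"
        unfolding k_def
      proof (intro integral_upper sol_cont_delayed)
        fix s assume s: "s \<in> {0..\<tau>}"
        have "f (z (u - s)) \<le> \<epsilon> * z (u - s) + C"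
          using s u elim tau_pos by (intro C sol_nonneg) auto
        also have "\<dots> \<le> \<epsilon> * z t + C"
          using s u elim \<epsilon> by (intro add_right_mono mult_left_mono sol_mono) auto
        finally show "f (z (u - s)) \<le> \<epsilon> * z t + C" .
      qed (use u elim tau_pos in auto)
      then show "0 \<le> k - (LINT s|\<mu>. f (z (u - s)))" by simp
    qed (use elim tau_pos in auto)
    then have "z t - z (t - \<tau>) \<le> k * \<tau>" by (simp add: algebra_simps)
    also have "\<dots> = \<eta> / 2 * z t + \<tau> * M * C"
      using tau_pos M_pos by (simp add: k_def \<epsilon>_def field_simps)
    also have "\<dots> \<le> \<eta> * z t"
      using elim(1) \<eta> by (simp add: field_simps)
    finally have "z t / \<delta> \<le> z (t - \<tau>)"
      by (simp add: \<eta>_def algebra_simps)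
    then show ?case using \<delta> by (simp add: field_simps)
  qed
qed

text \<open>All delayed values lie between \<open>z (t - \<tau>)\<close> and \<open>z t\<close>, and
  the lag estimate puts these within the factor \<open>\<delta>\<close> for which
  \<open>uniform_ratio\<close> compares values of \<open>f\<close>. Integration over total mass
  \<open>M\<close> keeps the bounds.\<close>

lemma sol_deriv_ratio: "((\<lambda>t. (LINT s|\<mu>. f (z (t - s))) / f (z t) / M) \<longlongrightarrow> 1) at_top"
proof (rule tendstoI)
  fix e :: real assume e: "0 < e"
  define \<epsilon> where "\<epsilon> = e / 2"
  have \<epsilon>: "0 < \<epsilon>" using e by (simp add: \<epsilon>_def)
  obtain \<delta> X where \<delta>: "1 < \<delta>" and X: "0 < X"
    and ratio: "\<And>x y. X \<le> x \<Longrightarrow> x \<le> y \<Longrightarrow> y \<le> \<delta> * x \<Longrightarrow> f y \<le> (1 + \<epsilon>) * f x \<and> f x \<le> (1 + \<epsilon>) * f y"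
    using uniform_ratio[OF \<epsilon>] by blast
  have "\<forall>\<^sub>F t in at_top. X \<le> z (t - \<tau>)"
    using sol_shift_at_top by (simp add: filterlim_at_top)
  then show "\<forall>\<^sub>F t in at_top. dist ((LINT s|\<mu>. f (z (t - s))) / f (z t) / M) 1 < e"
    using sol_lag[OF \<delta>] eventually_ge_at_top[of \<tau>]
  proof eventually_elim
    case (elim t)
    have t: "0 \<le> t" using elim tau_pos by simp
    have fz: "0 < f (z t)" using t tau_pos by (intro pos sol_nonneg) simp
    have rat: "f (z t) \<le> (1 + \<epsilon>) * f (z (t - s)) \<and> f (z (t - s)) \<le> (1 + \<epsilon>) * f (z t)"
      if s: "s \<in> {0..\<tau>}" for s
    proof (rule ratio)
      have lo: "z (t - \<tau>) \<le> z (t - s)" using s elim by (intro sol_mono) auto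
      then show "X \<le> z (t - s)" using elim by simp
      show "z (t - s) \<le> z t" using s elim by (intro sol_mono) auto
      have "\<delta> * z (t - \<tau>) \<le> \<delta> * z (t - s)" using lo \<delta> by simp
      then show "z t \<le> \<delta> * z (t - s)" using elim by simp
    qed
    have upper: "(LINT s|\<mu>. f (z (t - s))) \<le> M * ((1 + \<epsilon>) * f (z t))"
      using rat by (intro integral_upper sol_cont_delayed t) auto
    have "M * (f (z t) / (1 + \<epsilon>)) \<le> (LINT s|\<mu>. f (z (t - s)))"
      using rat \<epsilon> by (intro integral_lower sol_cont_delayed t) (auto simp: divide_le_eq mult.commute)
    moreover have "M * ((1 - \<epsilon>) * f (z t)) \<le> M * (f (z t) / (1 + \<epsilon>))"
    proof (intro mult_left_mono)
      \<comment> \<open>Replaces the lower factor \<open>1 / (1 + \<epsilon>)\<close> by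
        \<open>1 - \<epsilon>\<close>, symmetric to the upper one.\<close>
      have "(1 - \<epsilon>) * (1 + \<epsilon>) \<le> 1" by (simp add: algebra_simps)
      then have "(1 - \<epsilon>) \<le> 1 / (1 + \<epsilon>)" using \<epsilon> by (simp add: le_divide_eq)
      then have "(1 - \<epsilon>) * f (z t) \<le> 1 / (1 + \<epsilon>) * f (z t)" using fz by (intro mult_right_mono) auto
      then show "(1 - \<epsilon>) * f (z t) \<le> f (z t) / (1 + \<epsilon>)" by simp
    qed (use M_pos in auto)
    ultimately have "M * ((1 - \<epsilon>) * f (z t)) \<le> (LINT s|\<mu>. f (z (t - s)))" by simp
    then have "1 - \<epsilon> \<le> (LINT s|\<mu>. f (z (t - s))) / f (z t) / M"
      using fz M_pos by (simp add: le_divide_eq mult_ac)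
    moreover have "(LINT s|\<mu>. f (z (t - s))) / f (z t) / M \<le> 1 + \<epsilon>"
      using upper fz M_pos by (simp add: divide_le_eq mult_ac)
    ultimately show ?case using e unfolding dist_real_def \<epsilon>_def by linarith
  qed
qed

text \<open>Separation of variables: \<open>osgood f (z t)\<close> has derivative
  \<open>z' / f (z t)\<close>, which tends to \<open>M\<close>, so l'Hospital compares it with
  \<open>M * t\<close>.\<close>

lemma sol_asymptotics: "((\<lambda>t. z t / osgood_inv f (M * t)) \<longlongrightarrow> 1) at_top"
proof (rule osgood_inv_asymptotics[OF sol_at_top M_pos])
  show "((\<lambda>t. osgood f (z t) / (M * t)) \<longlongrightarrow> 1) at_top"
  proof (rule lhospital_at_top_at_top)
    show "filterlim (\<lambda>t. M * t) at_top at_top"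
      using M_pos by (intro filterlim_tendsto_pos_mult_at_top[OF tendsto_const] filterlim_ident) auto
    have "\<forall>\<^sub>F t in at_top. 0 < z t" using sol_at_top by (simp add: filterlim_at_top_dense)
    then show "\<forall>\<^sub>F t in at_top. ((\<lambda>t. osgood f (z t)) has_real_derivative
        1 / f (z t) * (LINT s|\<mu>. f (z (t - s)))) (at t)"
      using eventually_gt_at_top[of 0]
    proof eventually_elim
      case (elim t)
      then show ?case
        using sol_deriv[of t] at_within_Ici_pos[of t]
        by (intro DERIV_chain2[OF osgood_DERIV]) auto
    qed
    show "\<forall>\<^sub>F t in at_top. ((*) M has_real_derivative M) (at t)"
      by (intro always_eventually allI) (auto intro!: derivative_eq_intros)
    show "((\<lambda>t. 1 / f (z t) * (LINT s|\<mu>. f (z (t - s))) / M) \<longlongrightarrow> 1) at_top"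
      using sol_deriv_ratio by simp
  qed (use M_pos in simp)
qed

end

end

theorem theorem14:
  fixes \<tau> M :: real and \<mu> :: "real measure" and f \<psi> :: "real \<Rightarrow> real"
  assumes "0 < \<tau>"
    and "sets \<mu> = sets (restrict_space borel {0..\<tau>})"
    and "emeasure \<mu> {0..\<tau>} = ennreal M" and "0 < M"
    and "continuous_on {0..} f" and "\<forall>x\<ge>0. 0 < f x"
    and "locally_lipschitz_on {0..} f"
    and "regularly_varying 0 f"
    and "continuous_on {-\<tau>..0} \<psi>" and "\<forall>t\<in>{-\<tau>..0}. 0 < \<psi> t"
  shows "(\<exists>z. delay_solution \<tau> \<mu> f \<psi> z \<and>
            (\<forall>w. delay_solution \<tau> \<mu> f \<psi> w \<longrightarrow> (\<forall>t\<ge>-\<tau>. w t = z t))) \<and>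
         (\<forall>z. delay_solution \<tau> \<mu> f \<psi> z \<longrightarrow>
            filterlim z at_top at_top \<and>
            ((\<lambda>t. z t / osgood_inv f (M * t)) \<longlongrightarrow> 1) at_top)"
proof -
  interpret delay_problem \<tau> M \<mu> f \<psi>
    using assms by unfold_locales auto
  show ?thesis
    using solution_exists solution_unique sol_at_top sol_asymptotics by blast
qed

end
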